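(* Let $G$ be a finite abelian $2$-group and let $H$ be a maximal elementary abelian subgroup of $G$. If $H\cong\mathbb{Z}_2^t$, then $\omega(\Gamma(G))=\omega(\Gamma(H))=2^t$.
   Context: For a finite group $G$, the prime order element graph $\Gamma(G)$ is the simple undirected graph with vertex set $G$ in which two distinct vertices $x,y\in G$ are adjacent if and only if the order of the product $xy$ is a prime number. $\omega(\Gamma)$ denotes the clique number of a graph $\Gamma$, i.e. the maximum number of vertices in a clique. $\mathbb{Z}_2^t$ is the direct product of $t$ copies of the cyclic group of order $2$. *)

theory Defs
  imports "HOL-Algebra.Product_Groups" "HOL-Algebra.Multiplicative_Group"
    "HOL-Computational_Algebra.Primes" "HOL-Library.Ramsey"
begin

definition p_group :: "nat \<Rightarrow> ('a, 'b) monoid_scheme \<Rightarrow> bool" where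
  "p_group p G \<longleftrightarrow>
     group G \<and> prime p \<and> (\<forall>x\<in>carrier G. \<exists>n. group.ord G x = p ^ n)"

text \<open>The trivial group counts as elementary abelian, being the zeroth power of the cyclic group of order two.\<close>

definition elementary_abelian :: "('a, 'b) monoid_scheme \<Rightarrow> bool" where
  "elementary_abelian G \<longleftrightarrow>
     comm_group G \<and>
     (\<exists>p::nat. prime p \<and> (\<forall>x\<in>carrier G. x \<noteq> \<one>\<^bsub>G\<^esub> \<longrightarrow> group.ord G x = p))"

definition maximal_elementary_abelian_subgroup ::
    "'a set \<Rightarrow> ('a, 'b) monoid_scheme \<Rightarrow> bool" where
  "maximal_elementary_abelian_subgroup H G \<longleftrightarrow>
     subgroup H G \<and> elementary_abelian (G\<lparr>carrier := H\<rparr>) \<and>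
     (\<forall>K. subgroup K G \<and> elementary_abelian (G\<lparr>carrier := K\<rparr>) \<and> H \<subseteq> K \<longrightarrow> K = H)"

definition Z2_power :: "nat \<Rightarrow> (nat \<Rightarrow> int) monoid" where
  "Z2_power t = product_group {..<t} (\<lambda>_. integer_mod_group 2)"

text \<open>
  A simple undirected graph is a pair of its vertex set and its set of edges, an edge being
  a two-element set of vertices; this is the format of the library predicate \<^const>\<open>clique\<close>.
\<close>

type_synonym 'a ugraph = "'a set \<times> 'a set set"

definition prime_order_element_graph :: "('a, 'b) monoid_scheme \<Rightarrow> 'a ugraph" where
  "prime_order_element_graph G =
     (carrier G,
      {{x, y} | x y. x \<in> carrier G \<and> y \<in> carrier G \<and> x \<noteq> y \<and>
                     prime (group.ord G (x \<otimes>\<^bsub>G\<^esub> y))})"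

text \<open>Meaningful for graphs with finitely many vertices, where the maximum exists.\<close>

definition clique_number :: "'a ugraph \<Rightarrow> nat" where
  "clique_number \<Gamma> = Max (card ` {C. C \<subseteq> fst \<Gamma> \<and> clique C (snd \<Gamma>)})"

text \<open>
  The edge set above does not depend on the order in which the endpoints are multiplied:
  \<open>x \<otimes> y\<close> and \<open>y \<otimes> x\<close> are conjugate, hence have the same order.
\<close>

lemma (in group) ord_mult_commute:
  assumes x: "x \<in> carrier G" and y: "y \<in> carrier G"
  shows "ord (x \<otimes> y) = ord (y \<otimes> x)"
proof -
  have shift: "(a \<otimes> b) [^] n \<otimes> a = a \<otimes> (b \<otimes> a) [^] n"
    if "a \<in> carrier G" "b \<in> carrier G" for a b and n :: nat
  proof (induction n)
    case 0
    show ?case using that by simp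
  next
    case (Suc n)
    have "(a \<otimes> b) [^] Suc n \<otimes> a = ((a \<otimes> b) [^] n \<otimes> a) \<otimes> (b \<otimes> a)"
      using that by (simp add: m_assoc)
    also have "\<dots> = a \<otimes> (b \<otimes> a) [^] Suc n"
      using that by (simp add: Suc.IH m_assoc)
    finally show ?case .
  qed
  have one: "(b \<otimes> a) [^] n = \<one>"
    if a: "a \<in> carrier G" and b: "b \<in> carrier G" and 1: "(a \<otimes> b) [^] n = \<one>"
    for a b and n :: nat
  proof -
    have "a \<otimes> (b \<otimes> a) [^] n = a \<otimes> \<one>"
      using shift[OF a b, of n] 1 a by simp
    then show ?thesis
      using a b by (simp only: Units_l_cancel Units_eq m_closed nat_pow_closed one_closed)
  qed
  have "(x \<otimes> y) [^] n = \<one> \<longleftrightarrow> (y \<otimes> x) [^] n = \<one>" for n :: nat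
    using one[OF x y] one[OF y x] by blast
  then have "ord (x \<otimes> y) dvd n \<longleftrightarrow> ord (y \<otimes> x) dvd n" for n
    using x y by (simp flip: pow_eq_id)
  then show ?thesis
    by (meson dvd_antisym dvd_refl)
qed

lemma prime_order_element_graph_adj_iff:
  assumes "group G"
  shows "{x, y} \<in> snd (prime_order_element_graph G) \<longleftrightarrow>
           x \<in> carrier G \<and> y \<in> carrier G \<and> x \<noteq> y \<and>
           prime (group.ord G (x \<otimes>\<^bsub>G\<^esub> y))"
  using group.ord_mult_commute[OF assms, of x y]
  unfolding prime_order_element_graph_def by (auto simp: doubleton_eq_iff)

end

theory Submission
  imports Defs
begin

text \<open>Let \<open>S\<close> be \<open>square_root_one G\<close>, the kernel of squaring in an
  abelian group; the equation \<open>x \<otimes> x = \<one>\<close> admits the identity along with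
  the involutions. In an abelian 2-group \<open>S\<close> is the largest elementary abelian
  subgroup, so \<open>H = S\<close> (\<open>maximal_elementary_abelian_subgroup_2_group\<close>).
  Elements of prime order have order 2 and hence lie in \<open>S\<close>. Two distinct elements of
  \<open>S\<close> have a nontrivial product in \<open>S\<close>, so \<open>S\<close> is a clique
  (\<open>clique_involutions\<close>). Conversely, fix \<open>x\<close> in a clique; multiplication
  by \<open>x\<close> sends its other members injectively to nontrivial elements of
  \<open>S\<close>, so the clique has at most \<open>card S\<close> members
  (\<open>card_clique_le\<close>). The same count inside \<open>H\<close> gives
  \<open>card H\<close> again, and the isomorphism with \<open>Z2_power t\<close> makes this
  \<open>2 ^ t\<close>.\<close>

definition square_root_one :: "('a, 'b) monoid_scheme \<Rightarrow> 'a set" where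
  "square_root_one G = {x \<in> carrier G. x \<otimes>\<^bsub>G\<^esub> x = \<one>\<^bsub>G\<^esub>}"

lemma (in comm_group) subgroup_square_root_one: "subgroup (square_root_one G) G"
proof
  fix x y assume "x \<in> square_root_one G" "y \<in> square_root_one G"
  then have "x \<in> carrier G" "y \<in> carrier G" and xy: "x \<otimes> x = \<one>" "y \<otimes> y = \<one>"
    by (auto simp: square_root_one_def)
  moreover from this have "(x \<otimes> y) \<otimes> (x \<otimes> y) = (x \<otimes> x) \<otimes> (y \<otimes> y)"
    by (metis m_closed m_assoc m_comm)
  ultimately show "x \<otimes> y \<in> square_root_one G"
    by (simp add: square_root_one_def)
next
  fix x assume "x \<in> square_root_one G"
  then show "inv x \<in> square_root_one G"
    by (auto simp: square_root_one_def simp flip: inv_mult_group)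
qed (auto simp: square_root_one_def)

lemma (in comm_group) subgroup_imp_comm_group:
  assumes "subgroup H G"
  shows "comm_group (G\<lparr>carrier := H\<rparr>)"
  using subgroup_imp_group[OF assms] subgroup.subset[OF assms] m_comm
  by (intro group.group_comm_groupI) auto

lemma (in group) ord_eq_2_iff:
  assumes "x \<in> carrier G"
  shows "ord x = 2 \<longleftrightarrow> x \<otimes> x = \<one> \<and> x \<noteq> \<one>"
proof -
  have "x \<otimes> x = \<one> \<longleftrightarrow> ord x dvd 2"
    using assms pow_eq_id[of x 2] by (simp add: numeral_2_eq_2)
  moreover have "x = \<one> \<longleftrightarrow> ord x = 1"
    using assms ord_eq_1 by auto
  moreover have "ord x dvd 2 \<longleftrightarrow> ord x = 1 \<or> ord x = 2"
    using two_is_prime_nat by (auto simp: prime_nat_iff)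
  ultimately show ?thesis by auto
qed

text \<open>Powers of an element do not change when the carrier is restricted. This carries facts
  about \<open>elementary_abelian\<close> and \<open>p_group\<close> between a subgroup and the
  whole group.\<close>

lemma ord_subgroup_eq: "group.ord (G\<lparr>carrier := H\<rparr>) x = group.ord G x"
  if "subgroup H G" "group G"
  using that group.subgroup_imp_group[OF that(2,1)]
    monoid.nat_pow_consistent[OF group.is_monoid[OF that(2)], of _ _ H]
  by (simp add: group.ord_def)

lemma p_group_prime_ord:
  assumes "p_group p G" "x \<in> carrier G" "prime (group.ord G x)"
  shows "group.ord G x = p"
proof -
  obtain n where "group.ord G x = p ^ n"
    using assms(1,2) by (auto simp: p_group_def)
  then show ?thesis
    using assms(3) by (simp add: prime_power_iff)
qed

text \<open>The subgroup of square roots of the identity is itself elementary abelian and contains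
  every elementary abelian subgroup, so maximality leaves no other choice for
  \<open>H\<close>.\<close>

lemma maximal_elementary_abelian_subgroup_2_group:
  assumes "comm_group G" "p_group 2 G" "maximal_elementary_abelian_subgroup H G"
  shows "H = square_root_one G"
proof -
  interpret comm_group G by fact
  let ?K = "square_root_one G"
  have H: "subgroup H G" and el: "elementary_abelian (G\<lparr>carrier := H\<rparr>)"
    and max: "\<And>K. subgroup K G \<Longrightarrow> elementary_abelian (G\<lparr>carrier := K\<rparr>) \<Longrightarrow> H \<subseteq> K \<Longrightarrow> K = H"
    using assms(3) by (auto simp: maximal_elementary_abelian_subgroup_def)
  \<comment> \<open>If \<open>H\<close> is trivial, this prime is arbitrary; it is identified with 2
    only at a nontrivial element of \<open>H\<close>.\<close>
  obtain p :: nat where "prime p" and p: "\<And>x. x \<in> H \<Longrightarrow> x \<noteq> \<one>\<^bsub>G\<^esub> \<Longrightarrow> ord x = p"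
    using el ord_subgroup_eq[OF H is_group] by (auto simp: elementary_abelian_def)
  have "H \<subseteq> ?K"
  proof
    fix x assume x: "x \<in> H"
    then have xG: "x \<in> carrier G" using H subgroup.subset by blast
    show "x \<in> ?K"
    proof (cases "x = \<one>\<^bsub>G\<^esub>")
      case False
      then have "ord x = 2"
        using p_group_prime_ord[OF assms(2) xG] p[OF x] \<open>prime p\<close> by simp
      then show ?thesis using xG ord_eq_2_iff by (simp add: square_root_one_def)
    qed (simp add: square_root_one_def)
  qed
  moreover have "elementary_abelian (G\<lparr>carrier := ?K\<rparr>)"
    unfolding elementary_abelian_def
    using subgroup_imp_comm_group[OF subgroup_square_root_one]
      ord_subgroup_eq[OF subgroup_square_root_one is_group] two_is_prime_nat
    by (auto intro!: exI[of _ 2] simp: ord_eq_2_iff) (auto simp: square_root_one_def ord_eq_2_iff)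
  ultimately show ?thesis using max subgroup_square_root_one by blast
qed

text \<open>Translating a clique by one of its elements \<open>x\<close> moves all other elements into \<open>S\<close>;
  the element \<open>x\<close> itself can be sent to \<open>\<one>\<close>, because \<open>\<one>\<close> does not have prime order.\<close>

lemma (in group) card_clique_le:
  assumes "C \<subseteq> carrier G" "clique C (snd (prime_order_element_graph G))"
    and "finite S" "\<one> \<in> S" "\<And>z. z \<in> carrier G \<Longrightarrow> prime (ord z) \<Longrightarrow> z \<in> S"
  shows "card C \<le> card S"
proof (cases "C = {}")
  case False
  then obtain x where x: "x \<in> C" by blast
  have pr: "prime (ord (x \<otimes> y))" if "y \<in> C" "y \<noteq> x" for y
    using assms(2) that x by (auto simp: clique_def prime_order_element_graph_adj_iff[OF is_group])
  have ne: "x \<otimes> y \<noteq> \<one>" if "y \<in> C" "y \<noteq> x" for y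
    using pr[OF that] by fastforce
  let ?f = "\<lambda>y. if y = x then \<one> else x \<otimes> y"
  have "inj_on ?f C"
  proof (rule inj_onI)
    fix y z assume yz: "y \<in> C" "z \<in> C" "?f y = ?f z"
    then have "y \<in> carrier G" "z \<in> carrier G" "x \<in> carrier G" using x assms(1) by auto
    then show "y = z" using yz ne[of y] ne[of z] by (auto simp del: r_one split: if_splits)
  qed
  moreover have "?f ` C \<subseteq> S"
    using assms(4) assms(5)[OF m_closed pr] assms(1) x by auto
  ultimately show ?thesis using assms(3) card_inj_on_le by blast
qed simp

lemma clique_number_eqI:
  assumes "finite (fst \<Gamma>)" "C \<subseteq> fst \<Gamma>" "clique C (snd \<Gamma>)"
    and "\<And>D. D \<subseteq> fst \<Gamma> \<Longrightarrow> clique D (snd \<Gamma>) \<Longrightarrow> card D \<le> card C"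
  shows "clique_number \<Gamma> = card C"
  unfolding clique_number_def using assms by (intro Max_eqI) auto

text \<open>Each element of \<open>S\<close> is its own inverse, so a product of two elements of
  \<open>S\<close> is trivial only if they coincide; otherwise it is an involution.\<close>

lemma (in group) clique_involutions:
  assumes "S \<subseteq> square_root_one G" "subgroup S G"
  shows "clique S (snd (prime_order_element_graph G))"
  unfolding clique_def
proof (intro ballI impI)
  fix x y assume *: "x \<in> S" "y \<in> S" "x \<noteq> y"
  then have c: "x \<in> carrier G" "y \<in> carrier G" "y \<otimes> y = \<one>"
    using assms by (auto simp: square_root_one_def)
  have "x \<otimes> y \<in> square_root_one G"
    using subgroup.m_closed[OF assms(2) *(1,2)] assms(1) by blast
  \<comment> \<open>Since \<open>y \<otimes> y = \<one>\<close>, the equation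
    \<open>x \<otimes> y = \<one>\<close> reads \<open>x \<otimes> y = y \<otimes> y\<close>, and
    cancelling \<open>y\<close> would give \<open>x = y\<close>.\<close>
  moreover have "x \<otimes> y \<noteq> \<one>"
    using \<open>x \<noteq> y\<close> right_cancel[OF c(2,1,2)] unfolding c(3) by simp
  ultimately have "ord (x \<otimes> y) = 2" using c by (simp add: ord_eq_2_iff square_root_one_def)
  then show "{x, y} \<in> snd (prime_order_element_graph G)"
    using * c by (simp add: prime_order_element_graph_adj_iff[OF is_group])
qed

text \<open>The square roots of the identity serve both as the clique attaining the maximum and as
  the bounding set in \<open>card_clique_le\<close>. The group is left general because the result is
  applied to \<open>G\<close> and to \<open>H\<close>.\<close>

lemma clique_number_2_group:
  assumes "comm_group G" "finite (carrier G)" "p_group 2 G"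
  shows "clique_number (prime_order_element_graph G) = card (square_root_one G)"
proof -
  interpret comm_group G by fact
  let ?S = "square_root_one G"
  have S: "?S \<subseteq> carrier G" by (auto simp: square_root_one_def)
  then have "finite ?S" using assms(2) finite_subset by blast
  moreover have "z \<in> ?S" if "z \<in> carrier G" "prime (ord z)" for z
    using p_group_prime_ord[OF assms(3) that] that by (simp add: ord_eq_2_iff square_root_one_def)
  ultimately show ?thesis
    using S assms(2) clique_involutions[OF order_refl subgroup_square_root_one]
      subgroup.one_closed[OF subgroup_square_root_one]
    by (intro clique_number_eqI) (auto simp: prime_order_element_graph_def intro!: card_clique_le)
qed

lemma card_Z2_power: "card (carrier (Z2_power t)) = 2 ^ t"
  by (simp add: Z2_power_def carrier_integer_mod_group card_PiE)

lemma p_group_subgroup: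
  assumes "p_group p G" "subgroup H G"
  shows "p_group p (G\<lparr>carrier := H\<rparr>)"
  using assms subgroup.subset[OF assms(2)] group.subgroup_imp_group[of G H]
  by (auto simp: p_group_def ord_subgroup_eq)

theorem theorem5p1:
  fixes G :: "('a, 'b) monoid_scheme" and H :: "'a set" and t :: nat
  assumes "comm_group G"
    and "finite (carrier G)"
    and "p_group 2 G"
    and "maximal_elementary_abelian_subgroup H G"
    and "G\<lparr>carrier := H\<rparr> \<cong> Z2_power t"
  shows "clique_number (prime_order_element_graph G) =
           clique_number (prime_order_element_graph (G\<lparr>carrier := H\<rparr>)) \<and>
         clique_number (prime_order_element_graph (G\<lparr>carrier := H\<rparr>)) = 2 ^ t"
proof -
  interpret comm_group G by fact
  have H: "H = square_root_one G"
    using maximal_elementary_abelian_subgroup_2_group assms by blast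
  have sub: "subgroup H G" by (simp add: H subgroup_square_root_one)
  have "card H = 2 ^ t"
    using iso_same_card[OF assms(5)] by (simp add: card_Z2_power)
  moreover have "clique_number (prime_order_element_graph G) = card H"
    using clique_number_2_group assms(1-3) H by blast
  moreover have "clique_number (prime_order_element_graph (G\<lparr>carrier := H\<rparr>)) = card H"
  proof -
    \<comment> \<open>Every element of \<open>H\<close> already squares to the identity, so passing
      to the square roots of the identity inside \<open>H\<close> loses nothing.\<close>
    have "square_root_one (G\<lparr>carrier := H\<rparr>) = H"
      unfolding H by (auto simp: square_root_one_def)
    moreover have "finite H" using assms(2) subgroup.subset[OF sub] finite_subset by blast
    ultimately show ?thesis
      using clique_number_2_group[of "G\<lparr>carrier := H\<rparr>"] subgroup_imp_comm_group[OF sub]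
        p_group_subgroup[OF assms(3) sub] by simp
  qed
  ultimately show ?thesis by simp
qed

end
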